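(* Let $0<\sigma_{\min}<1$, let $\sigma,\kappa\in\Phi_{\sigma_{\min}}$, and let $h\in C^1(\mathbb{R})$ be a window function satisfying, for all $t\in\mathbb{R}$, $|h(t)|\le \frac{\psi_h(t)}{1+|t|}$ and $|h'(t)|\le\frac{\varphi_h(t)}{1+t^2}$, where $\psi_h,\varphi_h$ are continuous, non-negative and bounded functions on $\mathbb{R}$. Then for every $f\in L^2(\mathbb{R})$, $$\|\mathcal{L}_\sigma f-\mathcal{L}_\kappa f\|_{L^2(\mathbb{R}^2)}\le C_1(h,\sigma,\kappa)\,\|\sigma-\kappa\|_\infty\,\|f\|_2,$$ where $$C_1(h,\sigma,\kappa)=\frac{\sqrt2}{2}\,\frac{\|\psi_h\|_\infty}{\sigma_{\min}}+\sqrt{\frac{\pi}{2}}\,\min\{\|\kappa\|_\infty^{1/2},\|\sigma\|_\infty^{1/2}\}\,\frac{\|\varphi_h\|_\infty}{\sigma_{\min}^{3/2}}.$$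
   Context: For $0<\sigma_{\min}<1$, $\Phi_{\sigma_{\min}}$ denotes the class of continuous functions $\sigma:\mathbb{R}\to\mathbb{R}$ with $\sigma(t)\ge\sigma_{\min}$ for all $t$ and $\sigma(t)\to1$ as $t\to\pm\infty$. For $\sigma\in\Phi_{\sigma_{\min}}$, a window $h$, and $t,\omega\in\mathbb{R}$, put $h_{t,\omega,\sigma}(x)=\sqrt{\sigma(t)}\,e^{2i\pi\omega x}\,h(\sigma(t)(x-t))$, and for $f\in L^2(\mathbb{R})$ put $\mathcal{L}_\sigma f(t,\omega)=\langle f,h_{t,\omega,\sigma}\rangle$, where $\langle f,g\rangle=\int_{\mathbb{R}}f\,\overline{g}$ is the $L^2(\mathbb{R})$ inner product. $\|\cdot\|_p$ is the $L^p(\mathbb{R})$ norm. *)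

theory Defs
  imports "HOL-Analysis.Analysis" "HOL-Probability.Essential_Supremum"
begin

text \<open>
  Elements of the Lebesgue spaces are represented by Lebesgue measurable functions, with no
  identification of functions that agree almost everywhere.
\<close>

definition L2_space :: "'a measure \<Rightarrow> ('a \<Rightarrow> complex) set" where
  "L2_space M = {f \<in> borel_measurable M. integrable M (\<lambda>x. (cmod (f x))\<^sup>2)}"

text \<open>Meaningful for members of \<^const>\<open>L2_space\<close> only: a divergent Bochner integral has value 0.\<close>

definition L2_norm :: "'a measure \<Rightarrow> ('a \<Rightarrow> complex) \<Rightarrow> real" where
  "L2_norm M f = sqrt (\<integral>x. (cmod (f x))\<^sup>2 \<partial>M)"

definition L2_inner :: "(real \<Rightarrow> complex) \<Rightarrow> (real \<Rightarrow> complex) \<Rightarrow> complex" where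
  "L2_inner f g = (\<integral>x. f x * cnj (g x) \<partial>lebesgue)"

text \<open>
  Essential suprema live in a complete linear order, hence the detour through \<^typ>\<open>ereal\<close>.
  For a function that is not essentially bounded the value is the default 0.
\<close>

definition Linf_norm :: "(real \<Rightarrow> real) \<Rightarrow> real" where
  "Linf_norm f = real_of_ereal (esssup lebesgue (\<lambda>x. ereal \<bar>f x\<bar>))"

definition scale_class :: "real \<Rightarrow> (real \<Rightarrow> real) set" where
  "scale_class \<sigma>\<^sub>m\<^sub>i\<^sub>n = {\<sigma>. continuous_on UNIV \<sigma> \<and> (\<forall>t. \<sigma> t \<ge> \<sigma>\<^sub>m\<^sub>i\<^sub>n) \<and>
     (\<sigma> \<longlongrightarrow> 1) at_top \<and> (\<sigma> \<longlongrightarrow> 1) at_bot}"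

definition atom :: "(real \<Rightarrow> complex) \<Rightarrow> (real \<Rightarrow> real) \<Rightarrow> real \<Rightarrow> real \<Rightarrow> real \<Rightarrow> complex" where
  "atom h \<sigma> t \<omega> x =
     of_real (sqrt (\<sigma> t)) * exp (2 * \<i> * of_real pi * of_real \<omega> * of_real x) * h (\<sigma> t * (x - t))"

definition transform ::
    "(real \<Rightarrow> complex) \<Rightarrow> (real \<Rightarrow> real) \<Rightarrow> (real \<Rightarrow> complex) \<Rightarrow> real \<times> real \<Rightarrow> complex" where
  "transform h \<sigma> f = (\<lambda>(t, \<omega>). L2_inner f (atom h \<sigma> t \<omega>))"

text \<open>The window enters the constant only through its majorants \<open>\<psi>\<close> and \<open>\<phi>\<close>.\<close>

definition C1 ::
    "real \<Rightarrow> (real \<Rightarrow> real) \<Rightarrow> (real \<Rightarrow> real) \<Rightarrow> (real \<Rightarrow> real) \<Rightarrow> (real \<Rightarrow> real) \<Rightarrow> real" where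
  "C1 \<sigma>\<^sub>m\<^sub>i\<^sub>n \<psi> \<phi> \<sigma> \<kappa> =
     sqrt 2 / 2 * (Linf_norm \<psi> / \<sigma>\<^sub>m\<^sub>i\<^sub>n) +
     sqrt (pi / 2) * min (Linf_norm \<kappa> powr (1 / 2)) (Linf_norm \<sigma> powr (1 / 2)) *
       (Linf_norm \<phi> / \<sigma>\<^sub>m\<^sub>i\<^sub>n powr (3 / 2))"

end

theory Submission
  imports Defs "HOL-Probability.Characteristic_Functions" "HOL-Real_Asymp.Real_Asymp"
begin

text \<open>
  For fixed \<open>t\<close> the difference of the two transforms is the Fourier transform in \<open>\<omega>\<close> of \<open>f\<close> times the
  conjugate of \<open>g\<^sub>t(x) = \<surd>\<sigma>(t) h(\<sigma>(t)(x - t)) - \<surd>\<kappa>(t) h(\<kappa>(t)(x - t))\<close>. By Bessel's inequality for the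
  Fourier transform and Tonelli, its squared norm is at most the integral over \<open>x\<close> of
  \<open>|f(x)|\<^sup>2 \<integral>|g\<^sub>t(x)|\<^sup>2 dt\<close>, so a bound of the inner integral uniform in \<open>x\<close> suffices. Splitting
  \<open>g\<^sub>t\<close> into \<open>(\<surd>\<sigma> - \<surd>\<kappa>) h(\<sigma>u)\<close> and \<open>\<surd>\<kappa> (h(\<sigma>u) - h(\<kappa>u))\<close>, \<open>u = x - t\<close>, and using the mean value theorem
  for the second part produces the profiles \<open>1 / (1 + s|u|)\<close> and \<open>|u| / (1 + s\<^sup>2u\<^sup>2)\<close> with
  \<open>s = \<sigma>\<^sub>m\<^sub>i\<^sub>n\<close>, whose squares integrate to \<open>2/s\<close> and \<open>\<pi>/(2s\<^sup>3)\<close>. Exchanging \<open>\<sigma>\<close> and \<open>\<kappa>\<close> gives the minimum.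
\<close>

subsection \<open>Bessel's inequality for the Fourier transform\<close>

text \<open>Needed both for two real variables and for a frequency paired with a point of the plane,
  hence the general Euclidean types.\<close>

lemma integrable_prod_mult:
  fixes f :: "'a :: euclidean_space \<Rightarrow> complex" and g :: "'b :: euclidean_space \<Rightarrow> complex"
  assumes "integrable lborel f" and "integrable lborel g"
  shows "integrable (lborel \<Otimes>\<^sub>M lborel) (\<lambda>(x, y). f x * g y)"
proof -
  have [measurable]: "f \<in> borel_measurable borel" "g \<in> borel_measurable borel"
    using assms by (auto dest: borel_measurable_integrable)
  show ?thesis
    using assms by (intro lborel_pair.Fubini_integrable) (auto simp: norm_mult)
qed

lemma gaussian_weight_integrable:
  fixes \<delta> :: real
  assumes "\<delta> > 0"
  shows "integrable lborel (\<lambda>\<omega>. exp (- (\<delta> * \<omega>)\<^sup>2 / 2))"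
proof -
  have "integrable lborel (\<lambda>x. sqrt (2 * pi) * std_normal_density (0 + \<delta> * x))"
    using assms by (intro integrable_mult_right lborel_integrable_real_affine) auto
  then show ?thesis
    by (simp add: std_normal_density_def)
qed

text \<open>After the substitution \<open>x = \<delta> * \<omega>\<close> this is the characteristic
  function of the standard normal law at \<open>2 * pi * z / \<delta>\<close>. The result is again a
  probability density, so its mass is 1 for every \<open>\<delta>\<close>; this is why Bessel's
  inequality comes out with constant 1.\<close>

lemma gaussian_weight_fourier:
  fixes \<delta> z :: real
  assumes "\<delta> > 0"
  shows "(\<integral>\<omega>. complex_of_real (exp (- (\<delta> * \<omega>)\<^sup>2 / 2)) * cis (2 * pi * \<omega> * z) \<partial>lborel)
    = complex_of_real (normal_density 0 (\<delta> / (2 * pi)) z)"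
proof -
  let ?t = "2 * pi * z / \<delta>"
  have "complex_of_real (exp (- ?t\<^sup>2 / 2)) = char std_normal_distribution ?t"
    by (simp add: char_std_normal_distribution)
  also have "\<dots> = (\<integral>x. std_normal_density x *\<^sub>R iexp (?t * x) \<partial>lborel)"
    by (simp add: char_def integral_density normal_density_nonneg)
  also have "\<dots> = \<bar>\<delta>\<bar> *\<^sub>R (\<integral>x. std_normal_density (0 + \<delta> * x) *\<^sub>R iexp (?t * (0 + \<delta> * x)) \<partial>lborel)"
    using assms by (intro lborel_integral_real_affine) auto
  also have "(\<integral>x. std_normal_density (0 + \<delta> * x) *\<^sub>R iexp (?t * (0 + \<delta> * x)) \<partial>lborel)
      = (\<integral>\<omega>. complex_of_real (1 / sqrt (2 * pi)) *
           (complex_of_real (exp (- (\<delta> * \<omega>)\<^sup>2 / 2)) * cis (2 * pi * \<omega> * z)) \<partial>lborel)"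
    using assms
    by (intro Bochner_Integration.integral_cong)
      (auto simp: std_normal_density_def cis_conv_exp scaleR_conv_of_real field_simps)
  also have "\<dots> = complex_of_real (1 / sqrt (2 * pi)) *
      (\<integral>\<omega>. complex_of_real (exp (- (\<delta> * \<omega>)\<^sup>2 / 2)) * cis (2 * pi * \<omega> * z) \<partial>lborel)"
    by simp
  finally have eq: "(\<integral>\<omega>. complex_of_real (exp (- (\<delta> * \<omega>)\<^sup>2 / 2)) * cis (2 * pi * \<omega> * z) \<partial>lborel)
      = complex_of_real (sqrt (2 * pi) / \<delta> * exp (- ?t\<^sup>2 / 2))"
    using assms by (simp add: scaleR_conv_of_real field_simps)
  have "sqrt (2 * pi * (\<delta> / (2 * pi))\<^sup>2) = \<delta> / sqrt (2 * pi)"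
    using assms by (simp add: real_sqrt_mult real_sqrt_divide power_divide field_simps)
  moreover have "- ?t\<^sup>2 / 2 = - z\<^sup>2 / (2 * (\<delta> / (2 * pi))\<^sup>2)"
    using assms by (simp add: power2_eq_square field_simps)
  ultimately have "normal_density 0 (\<delta> / (2 * pi)) z = sqrt (2 * pi) / \<delta> * exp (- ?t\<^sup>2 / 2)"
    by (simp add: normal_density_def)
  then show ?thesis using eq by simp
qed

text \<open>The factor \<open>2 * pi\<close> in the exponent matches the modulation of
  \<open>atom\<close> and makes the transform a contraction in the L2 norm. Where the integrand is
  not integrable the value is the default 0.\<close>

definition fourier_integral :: "(real \<Rightarrow> complex) \<Rightarrow> real \<Rightarrow> complex" where
  "fourier_integral F \<omega> = (\<integral>x. F x * cis (- (2 * pi * \<omega> * x)) \<partial>lborel)"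

lemma measurable_cis [measurable]: "cis \<in> borel_measurable borel"
  by (intro borel_measurable_continuous_onI continuous_intros)

lemma measurable_cnj [measurable]: "cnj \<in> borel_measurable borel"
  by (intro borel_measurable_continuous_onI continuous_intros)

lemma borel_measurable_fourier_integral [measurable]:
  assumes [measurable]: "F \<in> borel_measurable borel"
  shows "fourier_integral F \<in> borel_measurable borel"
  unfolding fourier_integral_def by measurable

text \<open>AM-GM bounds \<open>cmod (F x) * cmod (F y)\<close> by half the sum of the squares. In
  each half one variable occurs only in the kernel, whose integral over that variable is 1 by
  translation and reflection.\<close>

lemma nn_integral_convolution_quadratic:
  fixes F :: "real \<Rightarrow> complex" and G :: "real \<Rightarrow> real"
  assumes [measurable]: "F \<in> borel_measurable borel" "G \<in> borel_measurable borel"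
    and G: "\<And>x. G x \<ge> 0" "\<And>x. G (- x) = G x" "(\<integral>\<^sup>+x. G x \<partial>lborel) = 1"
  shows "(\<integral>\<^sup>+x. \<integral>\<^sup>+y. ennreal (cmod (F x) * cmod (F y) * G (x - y)) \<partial>lborel \<partial>lborel)
    \<le> (\<integral>\<^sup>+x. ennreal ((cmod (F x))\<^sup>2) \<partial>lborel)"
proof -
  let ?I = "\<integral>\<^sup>+x. ennreal ((cmod (F x))\<^sup>2) \<partial>lborel"
  have shift: "(\<integral>\<^sup>+y. ennreal (G (x - y)) \<partial>lborel) = 1" for x
    using nn_integral_real_affine[of "\<lambda>x. ennreal (G x)" "-1" x] G by simp
  have shift': "(\<integral>\<^sup>+x. ennreal (G (x - y)) \<partial>lborel) = 1" for y
    using nn_integral_real_affine[of "\<lambda>x. ennreal (G x)" "1" "-y"] G by simp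
  let ?h = "\<lambda>x. ennreal ((cmod (F x))\<^sup>2 / 2)"
  have "(\<integral>\<^sup>+x. \<integral>\<^sup>+y. ennreal (cmod (F x) * cmod (F y) * G (x - y)) \<partial>lborel \<partial>lborel)
    \<le> (\<integral>\<^sup>+x. \<integral>\<^sup>+y. ?h x * ennreal (G (x - y)) + ?h y * ennreal (G (x - y)) \<partial>lborel \<partial>lborel)"
  proof (intro nn_integral_mono)
    fix x y :: real
    have "cmod (F x) * cmod (F y) \<le> (cmod (F x))\<^sup>2 / 2 + (cmod (F y))\<^sup>2 / 2"
      using sum_squares_bound[of "cmod (F x)" "cmod (F y)"] by simp
    then have "cmod (F x) * cmod (F y) * G (x - y)
        \<le> (cmod (F x))\<^sup>2 / 2 * G (x - y) + (cmod (F y))\<^sup>2 / 2 * G (x - y)"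
      using G(1)[of "x - y"] by (metis distrib_right mult_right_mono)
    then show "ennreal (cmod (F x) * cmod (F y) * G (x - y))
        \<le> ?h x * ennreal (G (x - y)) + ?h y * ennreal (G (x - y))"
      using G(1)[of "x - y"] by (simp flip: ennreal_mult ennreal_plus)
  qed
  also have "\<dots> = (\<integral>\<^sup>+x. \<integral>\<^sup>+y. ?h x * ennreal (G (x - y)) \<partial>lborel \<partial>lborel)
      + (\<integral>\<^sup>+x. \<integral>\<^sup>+y. ?h y * ennreal (G (x - y)) \<partial>lborel \<partial>lborel)"
    by (simp add: nn_integral_add)
  also have "(\<integral>\<^sup>+x. \<integral>\<^sup>+y. ?h x * ennreal (G (x - y)) \<partial>lborel \<partial>lborel) = (\<integral>\<^sup>+x. ?h x \<partial>lborel)"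
    by (simp add: nn_integral_cmult shift)
  also have "(\<integral>\<^sup>+x. \<integral>\<^sup>+y. ?h y * ennreal (G (x - y)) \<partial>lborel \<partial>lborel)
      = (\<integral>\<^sup>+y. \<integral>\<^sup>+x. ?h y * ennreal (G (x - y)) \<partial>lborel \<partial>lborel)"
    by (rule lborel_pair.Fubini') simp
  also have "\<dots> = (\<integral>\<^sup>+x. ?h x \<partial>lborel)"
    by (simp add: nn_integral_cmult shift')
  also have "(\<integral>\<^sup>+x. ?h x \<partial>lborel) + (\<integral>\<^sup>+x. ?h x \<partial>lborel) = ?I"
    by (simp flip: nn_integral_add ennreal_plus)
  finally show ?thesis .
qed

text \<open>
  With a Gaussian weight in frequency, Fubini turns the left side into a quadratic form in \<open>F\<close> whose
  kernel is a probability density in \<open>x - y\<close>.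
\<close>

lemma fourier_integral_weighted_le:
  fixes F :: "real \<Rightarrow> complex"
  assumes F: "integrable lborel F" and "\<delta> > 0"
  shows "(\<integral>\<^sup>+\<omega>. ennreal (exp (- (\<delta> * \<omega>)\<^sup>2 / 2) * (cmod (fourier_integral F \<omega>))\<^sup>2) \<partial>lborel)
    \<le> (\<integral>\<^sup>+x. ennreal ((cmod (F x))\<^sup>2) \<partial>lborel)"
proof -
  have [measurable]: "F \<in> borel_measurable borel"
    using F by (auto dest: borel_measurable_integrable)
  define w where "w = (\<lambda>\<omega>. exp (- (\<delta> * \<omega>)\<^sup>2 / 2))"
  have [measurable]: "w \<in> borel_measurable borel" unfolding w_def by measurable
  have w: "integrable lborel w" unfolding w_def by (rule gaussian_weight_integrable[OF assms(2)])
  define E where "E = (\<lambda>\<omega> x. F x * cis (- (2 * pi * \<omega> * x)))"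
  have [measurable]: "case_prod E \<in> borel_measurable (borel \<Otimes>\<^sub>M borel)"
    unfolding E_def by measurable
  have FF: "integrable (lborel \<Otimes>\<^sub>M lborel) (\<lambda>(x, y). F x * cnj (F y))"
    by (rule integrable_prod_mult) (use F in auto)
  \<comment> \<open>The weighted square of the transform becomes one integrand in the frequency and
    the point \<open>p = (x, y)\<close>. Keeping \<open>p\<close> as a single variable lets Fubini
    for two factors exchange frequency and space.\<close>
  define K where "K = (\<lambda>\<omega> (p :: real \<times> real). of_real (w \<omega>) * (E \<omega> (fst p) * cnj (E \<omega> (snd p))))"
  have [measurable]: "case_prod K \<in> borel_measurable (borel \<Otimes>\<^sub>M (borel \<Otimes>\<^sub>M borel))"
    unfolding K_def E_def by measurable
  then have K_borel: "case_prod K \<in> borel_measurable borel"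
    by (simp add: borel_prod)
  \<comment> \<open>The phases have modulus 1, so \<open>K\<close> has the modulus of a product of
    integrable functions.\<close>
  have K_norm: "norm (K \<omega> p) = norm (complex_of_real (w \<omega>) * (case p of (x, y) \<Rightarrow> F x * cnj (F y)))" for \<omega> p
    by (simp add: K_def E_def norm_mult split_beta)
  have "integrable (lborel \<Otimes>\<^sub>M lborel)
      (\<lambda>(\<omega>, p :: real \<times> real). complex_of_real (w \<omega>) * (case p of (x, y) \<Rightarrow> F x * cnj (F y)))"
    using w FF by (intro integrable_prod_mult) (auto simp: lborel_prod)
  then have K_int: "integrable (lborel \<Otimes>\<^sub>M lborel) (case_prod K)"
    by (rule Bochner_Integration.integrable_bound) (auto simp: K_norm lborel_prod K_borel)
  have int1: "(\<integral>p. K \<omega> p \<partial>lborel) = of_real (w \<omega> * (cmod (fourier_integral F \<omega>))\<^sup>2)" for \<omega>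
  proof -
    have E: "integrable lborel (E \<omega>)"
      using F by (rule Bochner_Integration.integrable_bound) (auto simp: E_def norm_mult)
    have E_eq: "fourier_integral F \<omega> = integral\<^sup>L lborel (E \<omega>)"
      by (simp add: fourier_integral_def E_def)
    have "(\<integral>p. K \<omega> p \<partial>lborel) = of_real (w \<omega>) * (\<integral>(x, y). E \<omega> x * cnj (E \<omega> y) \<partial>(lborel \<Otimes>\<^sub>M lborel))"
      by (simp add: K_def lborel_prod case_prod_unfold)
    also have "(\<integral>(x, y). E \<omega> x * cnj (E \<omega> y) \<partial>(lborel \<Otimes>\<^sub>M lborel))
        = (\<integral>x. \<integral>y. E \<omega> x * cnj (E \<omega> y) \<partial>lborel \<partial>lborel)"
      using lborel_pair.integral_fst'[OF integrable_prod_mult[of "E \<omega>" "\<lambda>y. cnj (E \<omega> y)"]] E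
      by simp
    also have "\<dots> = fourier_integral F \<omega> * cnj (fourier_integral F \<omega>)"
      by (simp add: E_eq)
    finally show ?thesis
      by (simp only: of_real_mult complex_norm_square)
  qed
  have int2: "(\<integral>\<omega>. K \<omega> (x, y) \<partial>lborel) = F x * cnj (F y) * of_real (normal_density 0 (\<delta> / (2 * pi)) (x - y))"
    for x y
  proof -
    have "(\<integral>\<omega>. K \<omega> (x, y) \<partial>lborel)
      = (\<integral>\<omega>. (F x * cnj (F y)) * (complex_of_real (w \<omega>) * cis (2 * pi * \<omega> * (y - x))) \<partial>lborel)"
      by (intro Bochner_Integration.integral_cong)
        (auto simp: K_def E_def cis_cnj cis_mult algebra_simps)
    also have "\<dots> = F x * cnj (F y) * of_real (normal_density 0 (\<delta> / (2 * pi)) (y - x))"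
      using gaussian_weight_fourier[OF assms(2), of "y - x"] by (simp add: w_def)
    finally show ?thesis
      by (simp add: normal_density_def power2_commute)
  qed
  have "(\<integral>\<^sup>+\<omega>. ennreal (w \<omega> * (cmod (fourier_integral F \<omega>))\<^sup>2) \<partial>lborel)
      = (\<integral>\<^sup>+\<omega>. ennreal (cmod (\<integral>p. K \<omega> p \<partial>lborel)) \<partial>lborel)"
    unfolding int1 norm_of_real by (simp add: w_def)
  \<comment> \<open>By \<open>int1\<close> the inner integrals are real and nonnegative, so putting
    the modulus outside loses nothing. It turns the expression into a Bochner integral of a complex
    function, to which Fubini applies.\<close>
  also have "\<dots> = ennreal (cmod (\<integral>\<omega>. \<integral>p. K \<omega> p \<partial>lborel \<partial>lborel))"
  proof -
    have i: "integrable lborel (\<lambda>\<omega>. \<integral>p. K \<omega> p \<partial>lborel)"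
      using lborel_pair.integrable_fst'[OF K_int] by simp
    then have i': "integrable lborel (\<lambda>\<omega>. w \<omega> * (cmod (fourier_integral F \<omega>))\<^sup>2)"
      unfolding int1 by (simp only: complex_of_real_integrable_eq)
    have "(\<integral>\<^sup>+\<omega>. ennreal (w \<omega> * (cmod (fourier_integral F \<omega>))\<^sup>2) \<partial>lborel)
       = ennreal (\<integral>\<omega>. w \<omega> * (cmod (fourier_integral F \<omega>))\<^sup>2 \<partial>lborel)"
      by (intro nn_integral_eq_integral i') (simp add: w_def)
    moreover have "(\<integral>\<omega>. w \<omega> * (cmod (fourier_integral F \<omega>))\<^sup>2 \<partial>lborel) \<ge> 0"
      by (intro Bochner_Integration.integral_nonneg) (simp add: w_def)
    ultimately show ?thesis
      unfolding int1 integral_complex_of_real norm_of_real by (simp add: w_def)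
  qed
  also have "(\<integral>\<omega>. \<integral>p. K \<omega> p \<partial>lborel \<partial>lborel) = (\<integral>p. \<integral>\<omega>. K \<omega> p \<partial>lborel \<partial>lborel)"
    using lborel_pair.Fubini_integral[OF K_int] by simp
  \<comment> \<open>With the frequency integrated out, \<open>int2\<close> leaves a positive
    Gaussian kernel, so after this estimate moduli remain only on the two factors of
    \<open>F\<close>.\<close>
  also have "ennreal (cmod \<dots>) \<le> (\<integral>\<^sup>+p. ennreal (cmod (\<integral>\<omega>. K \<omega> p \<partial>lborel)) \<partial>lborel)"
  proof (rule integral_norm_bound_ennreal)
    show "integrable lborel (\<lambda>p. \<integral>\<omega>. K \<omega> p \<partial>lborel)"
      using lborel_pair.integrable_snd[of K] K_int by simp
  qed
  also have "\<dots> = (\<integral>\<^sup>+x. \<integral>\<^sup>+y. ennreal (cmod (\<integral>\<omega>. K \<omega> (x, y) \<partial>lborel)) \<partial>lborel \<partial>lborel)"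
    unfolding lborel_prod[symmetric] by (subst lborel.nn_integral_fst) (auto)
  also have "\<dots> = (\<integral>\<^sup>+x. \<integral>\<^sup>+y. ennreal (cmod (F x) * cmod (F y) * normal_density 0 (\<delta> / (2 * pi)) (x - y)) \<partial>lborel \<partial>lborel)"
    unfolding int2 by (simp add: norm_mult)
  also have "\<dots> \<le> (\<integral>\<^sup>+x. ennreal ((cmod (F x))\<^sup>2) \<partial>lborel)"
    using assms(2)
    by (intro nn_integral_convolution_quadratic)
      (auto simp: nn_integral_eq_integral, auto simp: normal_density_def)
  finally show ?thesis by (simp add: w_def)
qed

text \<open>The weighted bound does not depend on \<open>\<delta>\<close>, so Fatou's lemma along
  \<open>\<delta> = 1 / (n + 1)\<close> removes the weight. The right side may be infinite.\<close>

lemma fourier_integral_L2_le: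
  fixes F :: "real \<Rightarrow> complex"
  assumes F: "integrable lborel F"
  shows "(\<integral>\<^sup>+\<omega>. ennreal ((cmod (fourier_integral F \<omega>))\<^sup>2) \<partial>lborel)
    \<le> (\<integral>\<^sup>+x. ennreal ((cmod (F x))\<^sup>2) \<partial>lborel)"
proof -
  have [measurable]: "F \<in> borel_measurable borel"
    using F by (auto dest: borel_measurable_integrable)
  let ?w = "\<lambda>n \<omega>. exp (- (inverse (real (Suc n)) * \<omega>)\<^sup>2 / 2) * (cmod (fourier_integral F \<omega>))\<^sup>2"
  have lim: "(\<lambda>n. ?w n \<omega>) \<longlonglongrightarrow> (cmod (fourier_integral F \<omega>))\<^sup>2" for \<omega>
    by (rule tendsto_eq_intros LIMSEQ_inverse_real_of_nat | simp)+
  have "(\<integral>\<^sup>+\<omega>. ennreal ((cmod (fourier_integral F \<omega>))\<^sup>2) \<partial>lborel)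
      = (\<integral>\<^sup>+\<omega>. liminf (\<lambda>n. ennreal (?w n \<omega>)) \<partial>lborel)"
    by (intro nn_integral_cong lim_imp_Liminf[symmetric] tendsto_ennrealI lim) auto
  also have "\<dots> \<le> liminf (\<lambda>n. \<integral>\<^sup>+\<omega>. ennreal (?w n \<omega>) \<partial>lborel)"
    by (rule nn_integral_liminf) measurable
  also have "\<dots> \<le> liminf (\<lambda>n. \<integral>\<^sup>+x. ennreal ((cmod (F x))\<^sup>2) \<partial>lborel)"
    by (intro Liminf_mono always_eventually allI fourier_integral_weighted_le[OF F]) simp
  also have "\<dots> = (\<integral>\<^sup>+x. ennreal ((cmod (F x))\<^sup>2) \<partial>lborel)"
    by (simp add: Liminf_const)
  finally show ?thesis .
qed

subsection \<open>Pointwise and integral estimates for the dilated windows\<close>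

text \<open>By continuity the set where \<open>\<bar>f x\<bar>\<close> is at most the essential
  supremum is closed; having full measure, it is the whole line. Boundedness keeps the supremum
  finite, so that \<open>real_of_ereal\<close> does not fall back to its default value.\<close>

lemma abs_le_Linf_norm:
  fixes f :: "real \<Rightarrow> real"
  assumes cont: "continuous_on UNIV f" and bound: "bounded (range f)"
  shows "\<bar>f t\<bar> \<le> Linf_norm f"
proof -
  let ?e = "esssup lebesgue (\<lambda>x. ereal \<bar>f x\<bar>)"
  obtain B where B: "\<bar>f x\<bar> \<le> B" for x
    using bound by (auto simp: bounded_iff)
  have "f \<in> borel_measurable borel"
    by (rule borel_measurable_continuous_onI[OF cont])
  then have meas: "(\<lambda>x. ereal \<bar>f x\<bar>) \<in> borel_measurable lebesgue"
    by (intro measurable_completion) measurable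
  have le: "ereal \<bar>f x\<bar> \<le> ?e" for x
  proof -
    have "closed {x. ereal \<bar>f x\<bar> \<le> ?e}"
      by (intro closed_Collect_le continuous_intros cont)
    moreover have "AE x in lebesgue. x \<in> {x. ereal \<bar>f x\<bar> \<le> ?e}"
      using esssup_AE[where f = "\<lambda>x. ereal \<bar>f x\<bar>"] by simp
    ultimately show ?thesis
      using mem_closed_if_AE_lebesgue by blast
  qed
  have "?e \<le> ereal B"
    using meas by (rule esssup_I) (simp add: B)
  then show ?thesis
    using le[of t] unfolding Linf_norm_def by (cases ?e) auto
qed

text \<open>The limits confine both tails to the ball of radius 1 around 1, and compactness bounds
  the part in between.\<close>

lemma scale_class_bounded:
  assumes "\<sigma> \<in> scale_class m"
  shows "bounded (range \<sigma>)"
proof -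
  have cont: "continuous_on UNIV \<sigma>" and top: "(\<sigma> \<longlongrightarrow> 1) at_top" and bot: "(\<sigma> \<longlongrightarrow> 1) at_bot"
    using assms by (auto simp: scale_class_def)
  obtain N where N: "\<And>t. t \<ge> N \<Longrightarrow> dist (\<sigma> t) 1 < 1"
    using tendstoD[OF top, of 1] by (auto simp: eventually_at_top_linorder)
  obtain M where M: "\<And>t. t \<le> M \<Longrightarrow> dist (\<sigma> t) 1 < 1"
    using tendstoD[OF bot, of 1] by (auto simp: eventually_at_bot_linorder)
  have "bounded (\<sigma> ` {M..N})"
    by (intro compact_imp_bounded compact_continuous_image continuous_on_subset[OF cont]) auto
  moreover have "range \<sigma> \<subseteq> \<sigma> ` {M..N} \<union> ball 1 1"
  proof (intro image_subsetI)
    fix t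
    show "\<sigma> t \<in> \<sigma> ` {M..N} \<union> ball 1 1"
      using M[of t] N[of t] by (cases "M \<le> t \<and> t \<le> N") (auto simp: dist_commute)
  qed
  ultimately show ?thesis
    by (meson bounded_Un bounded_ball bounded_subset)
qed

text \<open>Symmetry reduces the integral to the half-line, so an antiderivative is required only
  where \<open>\<bar>x\<bar> = x\<close>.\<close>

lemma nn_integral_even_FTC:
  fixes f F :: "real \<Rightarrow> real"
  assumes [measurable]: "f \<in> borel_measurable borel"
    and even: "\<And>x. f (- x) = f x" and nonneg: "\<And>x. 0 \<le> f x"
    and deriv: "\<And>x. 0 \<le> x \<Longrightarrow> (F has_real_derivative f x) (at x)"
    and lim: "(F \<longlongrightarrow> T) at_top" and "F 0 = 0" "0 \<le> T"
  shows "(\<integral>\<^sup>+x. ennreal (f x) \<partial>lborel) = ennreal (2 * T)"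
proof -
  have "(\<integral>\<^sup>+x. ennreal (indicator {0..} x * f x) \<partial>lborel) = (\<integral>\<^sup>+x. ennreal (f x) * indicator {0..} x \<partial>lborel)"
    by (intro nn_integral_cong) (auto split: split_indicator)
  also have "\<dots> = ennreal (T - F 0)"
    by (intro nn_integral_FTC_atLeast deriv nonneg lim) auto
  finally have "has_bochner_integral lborel (\<lambda>x. indicator {0..} x *\<^sub>R f x) T"
    using assms by (intro has_bochner_integral_nn_integral) auto
  then have "has_bochner_integral lborel f (2 *\<^sub>R T)"
    by (rule has_bochner_integral_even_function[where f = f]) (rule even)
  then have "integrable lborel f" "(\<integral>x. f x \<partial>lborel) = 2 * T"
    by (auto simp: has_bochner_integral_iff)
  then show ?thesis
    by (subst nn_integral_eq_integral) (auto simp: nonneg)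
qed

lemma nn_integral_decay:
  fixes s :: real
  assumes "s > 0"
  shows "(\<integral>\<^sup>+u. ennreal ((1 / (1 + s * \<bar>u\<bar>))\<^sup>2) \<partial>lborel) = ennreal (2 / s)"
proof -
  have "(\<integral>\<^sup>+u. ennreal ((1 / (1 + s * \<bar>u\<bar>))\<^sup>2) \<partial>lborel) = ennreal (2 * (1 / s))"
  proof (rule nn_integral_even_FTC[where F = "\<lambda>u. u / (1 + s * u)"])
    fix u :: real
    assume "0 \<le> u"
    then have "1 + s * u \<noteq> 0"
      using assms by (metis add_pos_nonneg less_imp_le less_irrefl mult_nonneg_nonneg zero_less_one)
    then have "((\<lambda>u. u / (1 + s * u)) has_real_derivative
        (1 * (1 + s * u) - u * s) / ((1 + s * u) * (1 + s * u))) (at u)"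
      by (intro DERIV_divide) (auto intro!: derivative_eq_intros)
    then show "((\<lambda>u. u / (1 + s * u)) has_real_derivative (1 / (1 + s * \<bar>u\<bar>))\<^sup>2) (at u)"
      using \<open>0 \<le> u\<close> by (simp add: power2_eq_square mult.commute)
  next
    show "((\<lambda>u. u / (1 + s * u)) \<longlongrightarrow> 1 / s) at_top"
      using assms by (real_asymp simp: inverse_eq_divide)
  qed (use assms in auto)
  then show ?thesis by simp
qed

lemma nn_integral_derivative_decay:
  fixes s :: real
  assumes "s > 0"
  shows "(\<integral>\<^sup>+u. ennreal ((\<bar>u\<bar> / (1 + s\<^sup>2 * u\<^sup>2))\<^sup>2) \<partial>lborel) = ennreal (pi / (2 * s ^ 3))"
proof -
  \<comment> \<open>Obtained by integrating
    \<open>u * (u / (1 + s\<^sup>2 * u\<^sup>2)\<^sup>2)\<close> by parts; at infinity only the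
    arctangent survives, with limit \<open>pi / 2\<close>.\<close>
  let ?F = "\<lambda>u. (arctan (s * u) - s * u / (1 + s\<^sup>2 * u\<^sup>2)) / (2 * s ^ 3)"
  have "(\<integral>\<^sup>+u. ennreal ((\<bar>u\<bar> / (1 + s\<^sup>2 * u\<^sup>2))\<^sup>2) \<partial>lborel) = ennreal (2 * (pi / (4 * s ^ 3)))"
  proof (rule nn_integral_even_FTC[where F = ?F])
    fix u :: real
    have pos: "1 + s\<^sup>2 * u\<^sup>2 > 0"
      by (simp add: add_pos_nonneg)
    have arctan: "((\<lambda>u. arctan (s * u)) has_real_derivative s / (1 + s\<^sup>2 * u\<^sup>2)) (at u)"
      by (auto intro!: derivative_eq_intros simp: power_mult_distrib divide_inverse)
    have quot: "((\<lambda>u. s * u / (1 + s\<^sup>2 * u\<^sup>2)) has_real_derivative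
        (s * (1 + s\<^sup>2 * u\<^sup>2) - s * u * (s\<^sup>2 * (2 * u))) / ((1 + s\<^sup>2 * u\<^sup>2) * (1 + s\<^sup>2 * u\<^sup>2))) (at u)"
      using pos by (intro DERIV_divide) (auto intro!: derivative_eq_intros)
    have "(?F has_real_derivative
        (s / (1 + s\<^sup>2 * u\<^sup>2) - (s * (1 + s\<^sup>2 * u\<^sup>2) - s * u * (s\<^sup>2 * (2 * u))) / (1 + s\<^sup>2 * u\<^sup>2)\<^sup>2)
          / (2 * s ^ 3)) (at u)"
      by (simp only: power2_eq_square[of "1 + s\<^sup>2 * u\<^sup>2"]) (rule DERIV_cdivide[OF DERIV_diff[OF arctan quot]])
    also have "(s / (1 + s\<^sup>2 * u\<^sup>2) - (s * (1 + s\<^sup>2 * u\<^sup>2) - s * u * (s\<^sup>2 * (2 * u))) / (1 + s\<^sup>2 * u\<^sup>2)\<^sup>2)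
        = 2 * s ^ 3 * (u\<^sup>2 / (1 + s\<^sup>2 * u\<^sup>2)\<^sup>2)"
      using pos by (simp add: divide_simps) (simp add: algebra_simps power2_eq_square power3_eq_cube)
    finally show "(?F has_real_derivative (\<bar>u\<bar> / (1 + s\<^sup>2 * u\<^sup>2))\<^sup>2) (at u)"
      using assms by (simp add: power_divide)
  next
    have "(?F \<longlongrightarrow> (pi / 2 - 0) / (2 * s ^ 3)) at_top"
      using assms
      by (intro tendsto_divide tendsto_diff tendsto_const filterlim_compose[OF tendsto_arctan_at_top])
        (real_asymp | simp)+
    then show "(?F \<longlongrightarrow> pi / (4 * s ^ 3)) at_top"
      by simp
  qed (use assms in auto)
  then show ?thesis by simp
qed

text \<open>
  The Minkowski inequality for two functions of known norms \<open>A\<close> and \<open>B\<close>, where it follows from the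
  weighted AM-GM inequality \<open>2pq \<le> (B/A) p\<^sup>2 + (A/B) q\<^sup>2\<close>.
\<close>

lemma nn_integral_quadratic_combination:
  fixes p q :: "real \<Rightarrow> real"
  assumes [measurable]: "p \<in> borel_measurable borel" "q \<in> borel_measurable borel"
    and p: "(\<integral>\<^sup>+u. ennreal ((p u)\<^sup>2) \<partial>lborel) = ennreal (A\<^sup>2)"
    and q: "(\<integral>\<^sup>+u. ennreal ((q u)\<^sup>2) \<partial>lborel) = ennreal (B\<^sup>2)"
    and "A > 0" "B > 0" "a \<ge> 0" "b \<ge> 0"
  shows "(\<integral>\<^sup>+u. ennreal ((a * p u + b * q u)\<^sup>2) \<partial>lborel) \<le> ennreal ((a * A + b * B)\<^sup>2)"
proof -
  \<comment> \<open>The coefficients that appear when the square is expanded and its cross term is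
    replaced by the AM-GM bound. The weights \<open>B / A\<close> and \<open>A / B\<close> are
    chosen so that \<open>c * A\<^sup>2 + d * B\<^sup>2\<close> is again a perfect square.\<close>
  define c where "c = a\<^sup>2 + a * b * (B / A)"
  define d where "d = b\<^sup>2 + a * b * (A / B)"
  have "c \<ge> 0" "d \<ge> 0"
    using assms by (auto simp: c_def d_def)
  have "(\<integral>\<^sup>+u. ennreal ((a * p u + b * q u)\<^sup>2) \<partial>lborel)
      \<le> (\<integral>\<^sup>+u. ennreal c * ennreal ((p u)\<^sup>2) + ennreal d * ennreal ((q u)\<^sup>2) \<partial>lborel)"
  proof (intro nn_integral_mono)
    fix u
    have "0 \<le> (B * p u - A * q u)\<^sup>2 / (A * B)"
      using assms by simp
    also have "\<dots> = B / A * (p u)\<^sup>2 + A / B * (q u)\<^sup>2 - 2 * p u * q u"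
      using assms by (simp add: field_simps power2_eq_square)
    finally have "2 * p u * q u \<le> B / A * (p u)\<^sup>2 + A / B * (q u)\<^sup>2" by simp
    then have "a * b * (2 * p u * q u) \<le> a * b * (B / A * (p u)\<^sup>2 + A / B * (q u)\<^sup>2)"
      using assms by (intro mult_left_mono) auto
    then have "(a * p u + b * q u)\<^sup>2 \<le> c * (p u)\<^sup>2 + d * (q u)\<^sup>2"
      by (simp add: c_def d_def power2_eq_square algebra_simps)
    then show "ennreal ((a * p u + b * q u)\<^sup>2) \<le> ennreal c * ennreal ((p u)\<^sup>2) + ennreal d * ennreal ((q u)\<^sup>2)"
      using \<open>c \<ge> 0\<close> \<open>d \<ge> 0\<close> by (simp flip: ennreal_mult ennreal_plus)
  qed
  also have "\<dots> = ennreal c * ennreal (A\<^sup>2) + ennreal d * ennreal (B\<^sup>2)"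
    by (simp add: nn_integral_add nn_integral_cmult p q)
  also have "\<dots> = ennreal (c * A\<^sup>2 + d * B\<^sup>2)"
    using \<open>c \<ge> 0\<close> \<open>d \<ge> 0\<close> by (simp flip: ennreal_mult ennreal_plus)
  also have "c * A\<^sup>2 = a\<^sup>2 * A\<^sup>2 + a * b * A * B"
    using \<open>A > 0\<close> by (simp add: c_def power2_eq_square distrib_right)
  also have "d * B\<^sup>2 = b\<^sup>2 * B\<^sup>2 + a * b * A * B"
    using \<open>B > 0\<close> by (simp add: d_def power2_eq_square distrib_right)
  also have "a\<^sup>2 * A\<^sup>2 + a * b * A * B + (b\<^sup>2 * B\<^sup>2 + a * b * A * B) = (a * A + b * B)\<^sup>2"
    by (simp add: power2_eq_square algebra_simps)
  finally show ?thesis .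
qed

text \<open>Inserting \<open>sqrt b * h (a * u)\<close> separates a change of amplitude, controlled
  by the decay of \<open>h\<close>, from a change of argument, controlled by the mean value
  inequality between \<open>b * u\<close> and \<open>a * u\<close>. The bound is asymmetric: of the
  two roots only \<open>sqrt b\<close> remains, which permits a choice later on.\<close>

lemma dilation_difference_le:
  fixes h h' :: "real \<Rightarrow> complex"
  assumes "0 < s" "s \<le> a" "s \<le> b"
    and decay: "\<And>t. cmod (h t) \<le> P / (1 + \<bar>t\<bar>)"
    and deriv: "\<And>t. (h has_vector_derivative h' t) (at t)"
    and deriv_decay: "\<And>t. cmod (h' t) \<le> Q / (1 + t\<^sup>2)"
  shows "cmod (of_real (sqrt a) * h (a * u) - of_real (sqrt b) * h (b * u))
    \<le> \<bar>a - b\<bar> * (P / (2 * sqrt s) * (1 / (1 + s * \<bar>u\<bar>)) + sqrt b * Q * (\<bar>u\<bar> / (1 + s\<^sup>2 * u\<^sup>2)))"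
proof -
  have "P \<ge> 0" using decay[of 0] norm_ge_zero[of "h 0"] by (simp del: norm_ge_zero)
  have "Q \<ge> 0" using deriv_decay[of 0] norm_ge_zero[of "h' 0"] by (simp del: norm_ge_zero)
  \<comment> \<open>Each point of the segment is \<open>u\<close> times a convex combination of
    \<open>a\<close> and \<open>b\<close>, hence a factor of at least \<open>s\<close>. The endpoint
    \<open>\<theta> = 1\<close> serves the decay bound at \<open>a * u\<close>.\<close>
  have scale_le: "s * \<bar>u\<bar> \<le> \<bar>b * u + \<theta> *\<^sub>R (a * u - b * u)\<bar>" if \<theta>: "\<theta> \<in> {0..1}" for \<theta> :: real
  proof -
    have "s = (1 - \<theta>) * s + \<theta> * s"
      by (simp add: left_diff_distrib)
    also have "\<dots> \<le> (1 - \<theta>) * b + \<theta> * a"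
      using assms(1-3) \<theta> by (intro add_mono mult_left_mono) auto
    finally have "s * \<bar>u\<bar> \<le> \<bar>(1 - \<theta>) * b + \<theta> * a\<bar> * \<bar>u\<bar>"
      using assms(1) by (intro mult_right_mono) auto
    also have "\<dots> = \<bar>b * u + \<theta> *\<^sub>R (a * u - b * u)\<bar>"
      by (simp add: algebra_simps flip: abs_mult)
    finally show ?thesis .
  qed
  \<comment> \<open>Multiplication by the conjugate sum, which is at least
    \<open>2 * sqrt s\<close>, produces the factor 1/2 in the first term of the constant.\<close>
  have sqrt_diff: "\<bar>sqrt a - sqrt b\<bar> \<le> \<bar>a - b\<bar> / (2 * sqrt s)"
  proof -
    have "(sqrt a - sqrt b) * (sqrt a + sqrt b) = a - b"
      using assms by (simp add: algebra_simps)
    then have "\<bar>a - b\<bar> = \<bar>sqrt a - sqrt b\<bar> * \<bar>sqrt a + sqrt b\<bar>"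
      by (simp flip: abs_mult)
    moreover have "2 * sqrt s \<le> \<bar>sqrt a + sqrt b\<bar>"
      using real_sqrt_le_mono[OF assms(2)] real_sqrt_le_mono[OF assms(3)] by linarith
    ultimately have "\<bar>sqrt a - sqrt b\<bar> * (2 * sqrt s) \<le> \<bar>a - b\<bar>"
      by (simp add: mult_left_mono)
    then show ?thesis
      using assms(1) by (simp add: pos_le_divide_eq)
  qed
  have "cmod (h (a * u)) \<le> P / (1 + \<bar>a * u\<bar>)" by (rule decay)
  also have "\<dots> \<le> P / (1 + s * \<bar>u\<bar>)"
    using \<open>P \<ge> 0\<close> assms(1) scale_le[of 1]
    by (intro divide_left_mono add_left_mono mult_pos_pos add_pos_nonneg) auto
  finally have first: "cmod (of_real (sqrt a - sqrt b) * h (a * u))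
      \<le> \<bar>a - b\<bar> / (2 * sqrt s) * (P / (1 + s * \<bar>u\<bar>))"
    unfolding norm_mult norm_of_real using sqrt_diff assms
    by (intro mult_mono) auto
  have "cmod (h (b * u + (a * u - b * u)) - h (b * u))
      \<le> norm (a * u - b * u) * (Q / (1 + s\<^sup>2 * u\<^sup>2))"
  \<comment> \<open>The derivative enters as the linear map \<open>x *\<^sub>R h' t\<close> of a
    real variable, whose operator norm is at most \<open>cmod (h' t)\<close>.\<close>
  proof (rule differentiable_bound_segment[where G = UNIV and f' = "\<lambda>t x. x *\<^sub>R h' t"])
    fix \<theta> :: real
    assume "\<theta> \<in> {0..1}"
    let ?v = "b * u + \<theta> *\<^sub>R (a * u - b * u)"
    from power_mono[OF scale_le[OF \<open>\<theta> \<in> {0..1}\<close>], of 2] have "s\<^sup>2 * u\<^sup>2 \<le> ?v\<^sup>2"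
      using assms(1) by (simp add: power_mult_distrib)
    then have "Q / (1 + ?v\<^sup>2) \<le> Q / (1 + s\<^sup>2 * u\<^sup>2)"
      using \<open>Q \<ge> 0\<close> by (intro divide_left_mono mult_pos_pos add_pos_nonneg) auto
    with deriv_decay[of ?v] have "cmod (h' ?v) \<le> Q / (1 + s\<^sup>2 * u\<^sup>2)"
      by (rule order_trans)
    then have "\<bar>x\<bar> * cmod (h' ?v) \<le> Q / (1 + s\<^sup>2 * u\<^sup>2) * \<bar>x\<bar>" for x
      by (subst mult.commute) (intro mult_right_mono, auto)
    then show "onorm (\<lambda>x. x *\<^sub>R h' ?v) \<le> Q / (1 + s\<^sup>2 * u\<^sup>2)"
      by (intro onorm_le) (simp only: norm_scaleR real_norm_def)
  qed (use deriv in \<open>auto simp: has_vector_derivative_def\<close>)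
  moreover have "\<bar>a * u - b * u\<bar> = \<bar>a - b\<bar> * \<bar>u\<bar>"
    by (simp flip: left_diff_distrib abs_mult)
  ultimately have "cmod (h (a * u) - h (b * u)) \<le> \<bar>a - b\<bar> * \<bar>u\<bar> * (Q / (1 + s\<^sup>2 * u\<^sup>2))"
    by simp
  then have second: "cmod (of_real (sqrt b) * (h (a * u) - h (b * u)))
      \<le> sqrt b * (\<bar>a - b\<bar> * \<bar>u\<bar> * (Q / (1 + s\<^sup>2 * u\<^sup>2)))"
    unfolding norm_mult norm_of_real using assms(1,3) by (intro mult_mono) auto
  have "of_real (sqrt a) * h (a * u) - of_real (sqrt b) * h (b * u)
      = of_real (sqrt a - sqrt b) * h (a * u) + of_real (sqrt b) * (h (a * u) - h (b * u))"
    by (simp add: algebra_simps)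
  then have "cmod (of_real (sqrt a) * h (a * u) - of_real (sqrt b) * h (b * u))
      \<le> \<bar>a - b\<bar> / (2 * sqrt s) * (P / (1 + s * \<bar>u\<bar>)) + sqrt b * (\<bar>a - b\<bar> * \<bar>u\<bar> * (Q / (1 + s\<^sup>2 * u\<^sup>2)))"
    by (simp only:) (rule order_trans[OF norm_triangle_ineq add_mono[OF first second]])
  then show ?thesis
    by (simp add: algebra_simps)
qed

subsection \<open>The difference of the transforms\<close>

lemma integrable_mult_square_integrable:
  fixes f g :: "'a \<Rightarrow> complex"
  assumes [measurable]: "f \<in> borel_measurable M" "g \<in> borel_measurable M"
    and "integrable M (\<lambda>x. (cmod (f x))\<^sup>2)" "integrable M (\<lambda>x. (cmod (g x))\<^sup>2)"
  shows "integrable M (\<lambda>x. f x * g x)"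
proof (rule Bochner_Integration.integrable_bound)
  show "integrable M (\<lambda>x. (cmod (f x))\<^sup>2 + (cmod (g x))\<^sup>2)"
    using assms by simp
  have "a * b \<le> a\<^sup>2 + b\<^sup>2" if "a \<ge> 0" "b \<ge> 0" for a b :: real
    using sum_squares_bound[of a b] mult_nonneg_nonneg[OF that] by linarith
  then show "AE x in M. norm (f x * g x) \<le> norm ((cmod (f x))\<^sup>2 + (cmod (g x))\<^sup>2)"
    by (simp add: norm_mult)
qed simp

text \<open>Stated for an arbitrary kernel \<open>G\<close>, so that it applies directly to a
  difference of two windows. Bessel's inequality is used in the frequency for each fixed
  \<open>t\<close>; Tonelli then leaves the integral over \<open>t\<close> acting on
  \<open>G\<close> alone.\<close>

lemma short_time_fourier_L2_le:
  fixes f :: "real \<Rightarrow> complex" and G :: "real \<Rightarrow> real \<Rightarrow> complex"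
  assumes [measurable]: "f \<in> borel_measurable borel" "case_prod G \<in> borel_measurable (borel \<Otimes>\<^sub>M borel)"
    and int: "\<And>t. integrable lborel (\<lambda>x. f x * G t x)"
    and bound: "\<And>x. (\<integral>\<^sup>+t. ennreal ((cmod (G t x))\<^sup>2) \<partial>lborel) \<le> C"
  shows "(\<integral>\<^sup>+(t, \<omega>). ennreal ((cmod (fourier_integral (\<lambda>x. f x * G t x) \<omega>))\<^sup>2) \<partial>(lborel \<Otimes>\<^sub>M lborel))
    \<le> C * (\<integral>\<^sup>+x. ennreal ((cmod (f x))\<^sup>2) \<partial>lborel)"
proof -
  have "(\<integral>\<^sup>+(t, \<omega>). ennreal ((cmod (fourier_integral (\<lambda>x. f x * G t x) \<omega>))\<^sup>2) \<partial>(lborel \<Otimes>\<^sub>M lborel))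
      = (\<integral>\<^sup>+t. \<integral>\<^sup>+\<omega>. ennreal ((cmod (fourier_integral (\<lambda>x. f x * G t x) \<omega>))\<^sup>2) \<partial>lborel \<partial>lborel)"
    unfolding fourier_integral_def by (subst lborel.nn_integral_fst[symmetric]) auto
  also have "\<dots> \<le> (\<integral>\<^sup>+t. \<integral>\<^sup>+x. ennreal ((cmod (f x * G t x))\<^sup>2) \<partial>lborel \<partial>lborel)"
    by (intro nn_integral_mono fourier_integral_L2_le int)
  also have "\<dots> = (\<integral>\<^sup>+x. \<integral>\<^sup>+t. ennreal ((cmod (f x * G t x))\<^sup>2) \<partial>lborel \<partial>lborel)"
    by (rule lborel_pair.Fubini') measurable
  also have "\<dots> = (\<integral>\<^sup>+x. ennreal ((cmod (f x))\<^sup>2) * (\<integral>\<^sup>+t. ennreal ((cmod (G t x))\<^sup>2) \<partial>lborel) \<partial>lborel)"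
    by (simp add: norm_mult power_mult_distrib ennreal_mult nn_integral_cmult)
  also have "\<dots> \<le> (\<integral>\<^sup>+x. ennreal ((cmod (f x))\<^sup>2) * C \<partial>lborel)"
    by (intro nn_integral_mono mult_left_mono bound) auto
  also have "\<dots> = C * (\<integral>\<^sup>+x. ennreal ((cmod (f x))\<^sup>2) \<partial>lborel)"
    by (simp add: nn_integral_cmult mult.commute)
  finally show ?thesis .
qed

text \<open>Members of \<open>L2_space lebesgue\<close> are only Lebesgue measurable, whereas the
  Fubini arguments run on \<open>lborel\<close>; a Borel representative bridges the two. Real and
  imaginary parts are treated separately.\<close>

lemma lebesgue_ex_borel_measurable_complex:
  fixes f :: "'a :: euclidean_space \<Rightarrow> complex"
  assumes [measurable]: "f \<in> borel_measurable lebesgue"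
  obtains g where "g \<in> borel_measurable borel" "AE x in lborel. f x = g x"
proof -
  have "(\<lambda>x. Re (f x)) \<in> borel_measurable lebesgue" "(\<lambda>x. Im (f x)) \<in> borel_measurable lebesgue"
    by measurable
  from this[THEN completion_ex_borel_measurable_real]
  obtain u v where [measurable]: "u \<in> borel_measurable lborel" "v \<in> borel_measurable lborel"
    and ae: "AE x in lborel. Re (f x) = u x" "AE x in lborel. Im (f x) = v x"
    by auto
  show ?thesis
  proof
    show "(\<lambda>x. of_real (u x) + \<i> * of_real (v x)) \<in> borel_measurable borel"
      by measurable
    show "AE x in lborel. f x = of_real (u x) + \<i> * of_real (v x)"
      using ae by eventually_elim (simp add: complex_eq_iff)
  qed
qed

text \<open>The atom stripped of its modulation, which \<open>fourier_integral\<close>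
  supplies.\<close>

definition dilated :: "(real \<Rightarrow> complex) \<Rightarrow> (real \<Rightarrow> real) \<Rightarrow> real \<Rightarrow> real \<Rightarrow> complex" where
  "dilated h \<sigma> t x = of_real (sqrt (\<sigma> t)) * h (\<sigma> t * (x - t))"

lemma measurable_dilated [measurable]:
  assumes [measurable]: "h \<in> borel_measurable borel" "\<sigma> \<in> borel_measurable borel"
  shows "case_prod (dilated h \<sigma>) \<in> borel_measurable (borel \<Otimes>\<^sub>M borel)"
  unfolding dilated_def by measurable

text \<open>Conjugating the modulation in the inner product gives the phase of
  \<open>fourier_integral\<close>. Passing to the Borel representative and from
  \<open>lebesgue\<close> to \<open>lborel\<close> leaves the integral unchanged.\<close>

lemma transform_eq_fourier_integral:
  assumes [measurable]: "f \<in> borel_measurable lebesgue" "g \<in> borel_measurable borel" "h \<in> borel_measurable borel"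
    and ae: "AE x in lborel. f x = g x"
  shows "transform h \<sigma> f (t, \<omega>) = fourier_integral (\<lambda>x. g x * cnj (dilated h \<sigma> t x)) \<omega>"
proof -
  have [measurable]: "atom h \<sigma> t \<omega> \<in> borel_measurable borel"
    unfolding atom_def by measurable
  have g [measurable]: "g \<in> borel_measurable lebesgue"
    by (intro measurable_completion) simp
  have atom [measurable]: "atom h \<sigma> t \<omega> \<in> borel_measurable lebesgue"
    by (intro measurable_completion) simp
  have "transform h \<sigma> f (t, \<omega>) = (\<integral>x. g x * cnj (atom h \<sigma> t \<omega> x) \<partial>lebesgue)"
    unfolding transform_def L2_inner_def prod.case
    using AE_completion[OF ae] by (intro integral_cong_AE) auto
  also have "\<dots> = (\<integral>x. g x * cnj (atom h \<sigma> t \<omega> x) \<partial>lborel)"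
    by (intro integral_completion) simp
  also have "\<dots> = fourier_integral (\<lambda>x. g x * cnj (dilated h \<sigma> t x)) \<omega>"
    unfolding fourier_integral_def atom_def dilated_def
    by (intro Bochner_Integration.integral_cong)
      (auto simp: cis_conv_exp exp_cnj mult_ac)
  finally show ?thesis .
qed

lemma nn_integral_shifted_reflected:
  fixes p :: "real \<Rightarrow> ennreal"
  assumes "p \<in> borel_measurable borel"
  shows "(\<integral>\<^sup>+t. p (x - t) \<partial>lborel) = (\<integral>\<^sup>+u. p u \<partial>lborel)"
  using nn_integral_real_affine[OF assms, of "-1" x] by simp

text \<open>Together with square integrability of the signal, this makes the inner products with the
  atoms genuine integrals and not default values.\<close>

lemma integrable_dilated_square:
  assumes [measurable]: "h \<in> borel_measurable borel" and "0 < s" "s \<le> \<sigma> t"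
    and decay: "\<And>t. cmod (h t) \<le> P / (1 + \<bar>t\<bar>)"
  shows "integrable lborel (\<lambda>x. (cmod (dilated h \<sigma> t x))\<^sup>2)"
proof (rule integrableI_bounded)
  have [measurable]: "dilated h \<sigma> t \<in> borel_measurable borel"
    unfolding dilated_def by measurable
  show "(\<lambda>x. (cmod (dilated h \<sigma> t x))\<^sup>2) \<in> borel_measurable lborel"
    by measurable
  have "(\<integral>\<^sup>+x. ennreal (norm ((cmod (dilated h \<sigma> t x))\<^sup>2)) \<partial>lborel)
      \<le> (\<integral>\<^sup>+x. ennreal (\<sigma> t * P\<^sup>2) * ennreal ((1 / (1 + \<sigma> t * \<bar>- t + 1 * x\<bar>))\<^sup>2) \<partial>lborel)"
  proof (intro nn_integral_mono)
    fix x
    have "(cmod (h (\<sigma> t * (x - t))))\<^sup>2 \<le> (P / (1 + \<bar>\<sigma> t * (x - t)\<bar>))\<^sup>2"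
      by (intro power_mono decay) auto
    then have "\<sigma> t * (cmod (h (\<sigma> t * (x - t))))\<^sup>2 \<le> \<sigma> t * (P / (1 + \<bar>\<sigma> t * (x - t)\<bar>))\<^sup>2"
      using assms by (intro mult_left_mono) auto
    also have "\<dots> = \<sigma> t * P\<^sup>2 * (1 / (1 + \<sigma> t * \<bar>- t + 1 * x\<bar>))\<^sup>2"
      using assms by (simp add: power_divide abs_mult)
    finally show "ennreal (norm ((cmod (dilated h \<sigma> t x))\<^sup>2))
        \<le> ennreal (\<sigma> t * P\<^sup>2) * ennreal ((1 / (1 + \<sigma> t * \<bar>- t + 1 * x\<bar>))\<^sup>2)"
      using assms by (simp add: dilated_def norm_mult power_mult_distrib flip: ennreal_mult)
  qed
  also have "\<dots> = ennreal (\<sigma> t * P\<^sup>2) * (\<integral>\<^sup>+u. ennreal ((1 / (1 + \<sigma> t * \<bar>u\<bar>))\<^sup>2) \<partial>lborel)"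
    using nn_integral_real_affine[of "\<lambda>u. ennreal ((1 / (1 + \<sigma> t * \<bar>u\<bar>))\<^sup>2)" 1 "-t"]
    by (simp add: nn_integral_cmult)
  also have "\<dots> = ennreal (\<sigma> t * P\<^sup>2) * ennreal (2 / \<sigma> t)"
    using assms by (subst nn_integral_decay) auto
  also have "\<dots> < \<infinity>"
    by (simp add: ennreal_mult_less_top)
  finally show "(\<integral>\<^sup>+x. ennreal (norm ((cmod (dilated h \<sigma> t x))\<^sup>2)) \<partial>lborel) < \<infinity>" .
qed

text \<open>The integration variable \<open>t\<close> also sits inside \<open>\<sigma> t\<close> and
  \<open>\<kappa> t\<close>, so the windows themselves admit no simple substitution. The pointwise
  majorant depends on \<open>t\<close> through \<open>x - t\<close> only; a reflected shift then
  removes \<open>x\<close>, which makes the bound uniform.\<close>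

lemma nn_integral_dilated_difference_le:
  fixes h h' :: "real \<Rightarrow> complex" and \<sigma> \<kappa> :: "real \<Rightarrow> real"
  assumes "0 < s" and \<sigma>: "\<And>t. s \<le> \<sigma> t" "\<And>t. \<sigma> t \<le> A" and \<kappa>: "\<And>t. s \<le> \<kappa> t" "\<And>t. \<kappa> t \<le> B"
    and diff: "\<And>t. \<bar>\<sigma> t - \<kappa> t\<bar> \<le> L"
    and decay: "\<And>t. cmod (h t) \<le> P / (1 + \<bar>t\<bar>)"
    and deriv: "\<And>t. (h has_vector_derivative h' t) (at t)"
    and deriv_decay: "\<And>t. cmod (h' t) \<le> Q / (1 + t\<^sup>2)"
  shows "(\<integral>\<^sup>+t. ennreal ((cmod (dilated h \<sigma> t x - dilated h \<kappa> t x))\<^sup>2) \<partial>lborel)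
    \<le> ennreal ((L * (P / (2 * sqrt s) * sqrt (2 / s) + min (sqrt B) (sqrt A) * Q * sqrt (pi / (2 * s ^ 3))))\<^sup>2)"
proof -
  let ?p = "\<lambda>u. 1 / (1 + s * \<bar>u\<bar>)" and ?q = "\<lambda>u. \<bar>u\<bar> / (1 + s\<^sup>2 * u\<^sup>2)"
  let ?a = "L * (P / (2 * sqrt s))" and ?b = "L * (min (sqrt B) (sqrt A) * Q)"
  have "P \<ge> 0" using decay[of 0] norm_ge_zero[of "h 0"] by (simp del: norm_ge_zero)
  have "Q \<ge> 0" using deriv_decay[of 0] norm_ge_zero[of "h' 0"] by (simp del: norm_ge_zero)
  have "L \<ge> 0" using diff[of 0] by linarith
  have "A \<ge> 0" "B \<ge> 0"
    using \<open>0 < s\<close> \<sigma>[of 0] \<kappa>[of 0] by auto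
  have pointwise: "cmod (dilated h \<sigma> t x - dilated h \<kappa> t x) \<le> ?a * ?p (x - t) + ?b * ?q (x - t)" for t
  proof -
    let ?d = "cmod (dilated h \<sigma> t x - dilated h \<kappa> t x)"
    let ?r = "\<lambda>m. P / (2 * sqrt s) * ?p (x - t) + m * Q * ?q (x - t)"
    have "?d \<le> \<bar>\<sigma> t - \<kappa> t\<bar> * ?r (sqrt (\<kappa> t))"
      unfolding dilated_def using \<open>0 < s\<close> \<sigma> \<kappa> decay deriv deriv_decay
      by (intro dilation_difference_le)
    moreover have "?d \<le> \<bar>\<kappa> t - \<sigma> t\<bar> * ?r (sqrt (\<sigma> t))"
      unfolding dilated_def using \<open>0 < s\<close> \<sigma> \<kappa> decay deriv deriv_decay
      by (subst norm_minus_commute, intro dilation_difference_le)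
    \<comment> \<open>The two estimates differ only in the root, so the smaller one may be taken
      separately at each \<open>t\<close>; monotonicity then replaces the pair of roots by their
      upper bounds.\<close>
    ultimately have "?d \<le> \<bar>\<sigma> t - \<kappa> t\<bar> * ?r (min (sqrt (\<kappa> t)) (sqrt (\<sigma> t)))"
      by (simp only: min_def abs_minus_commute[of "\<kappa> t"] simp_thms split: if_split)
    also have "\<dots> \<le> L * ?r (min (sqrt B) (sqrt A))"
    proof (intro mult_mono diff add_left_mono mult_right_mono)
      show "min (sqrt (\<kappa> t)) (sqrt (\<sigma> t)) \<le> min (sqrt B) (sqrt A)"
        using \<sigma>(2)[of t] \<kappa>(2)[of t] by (intro min.mono) auto
      show "0 \<le> ?r (min (sqrt (\<kappa> t)) (sqrt (\<sigma> t)))"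
        using \<open>0 < s\<close> \<open>P \<ge> 0\<close> \<open>Q \<ge> 0\<close> order_trans[OF less_imp_le \<sigma>(1)] order_trans[OF less_imp_le \<kappa>(1)]
        by (intro add_nonneg_nonneg mult_nonneg_nonneg divide_nonneg_nonneg) auto
    qed (use \<open>L \<ge> 0\<close> \<open>Q \<ge> 0\<close> \<open>A \<ge> 0\<close> \<open>B \<ge> 0\<close> in auto)
    finally show ?thesis
      by (simp add: algebra_simps)
  qed
  have "(\<integral>\<^sup>+t. ennreal ((cmod (dilated h \<sigma> t x - dilated h \<kappa> t x))\<^sup>2) \<partial>lborel)
      \<le> (\<integral>\<^sup>+t. ennreal ((?a * ?p (x - t) + ?b * ?q (x - t))\<^sup>2) \<partial>lborel)"
    by (intro nn_integral_mono ennreal_leI power_mono pointwise) auto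
  also have "\<dots> = (\<integral>\<^sup>+u. ennreal ((?a * ?p u + ?b * ?q u)\<^sup>2) \<partial>lborel)"
    by (rule nn_integral_shifted_reflected) measurable
  also have "\<dots> \<le> ennreal ((?a * sqrt (2 / s) + ?b * sqrt (pi / (2 * s ^ 3)))\<^sup>2)"
    using \<open>0 < s\<close> \<open>P \<ge> 0\<close> \<open>Q \<ge> 0\<close> \<open>L \<ge> 0\<close> \<open>A \<ge> 0\<close> \<open>B \<ge> 0\<close>
    by (intro nn_integral_quadratic_combination)
      (auto simp: nn_integral_decay nn_integral_derivative_decay)
  finally show ?thesis
    by (simp add: algebra_simps)
qed

text \<open>Displays the constant as two coefficients times the L2 norms \<open>sqrt (2 / s)\<close>
  and \<open>sqrt (pi / (2 * s ^ 3))\<close> of the two profiles, the form in which the estimate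
  delivers it.\<close>

lemma C1_eq_sqrt:
  assumes "0 < s" "0 \<le> Linf_norm \<sigma>" "0 \<le> Linf_norm \<kappa>"
  shows "C1 s \<psi> \<phi> \<sigma> \<kappa> = Linf_norm \<psi> / (2 * sqrt s) * sqrt (2 / s)
    + min (sqrt (Linf_norm \<kappa>)) (sqrt (Linf_norm \<sigma>)) * Linf_norm \<phi> * sqrt (pi / (2 * s ^ 3))"
proof -
  have "s powr (3 / 2) = s * sqrt s"
    using assms(1) powr_add[of s 1 "1 / 2"] by (simp add: powr_half_sqrt)
  moreover have "sqrt (pi / (2 * s ^ 3)) = sqrt (pi / 2) / (s * sqrt s)"
    using assms(1) by (simp add: power3_eq_cube real_sqrt_mult real_sqrt_divide)
  moreover have "Linf_norm \<psi> / (2 * sqrt s) * sqrt (2 / s) = sqrt 2 / 2 * (Linf_norm \<psi> / s)"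
    using assms(1) by (simp add: real_sqrt_divide field_simps)
  ultimately show ?thesis
    using assms(2,3) by (simp add: C1_def powr_half_sqrt)
qed

text \<open>Membership in \<open>L2_space\<close> accompanies the inequality because
  \<open>L2_norm\<close> would take the value 0 on a function whose square is not
  integrable.\<close>

theorem proposition1:
  fixes \<sigma>\<^sub>m\<^sub>i\<^sub>n :: real and \<sigma> \<kappa> \<psi> \<phi> :: "real \<Rightarrow> real" and h f :: "real \<Rightarrow> complex"
  assumes "0 < \<sigma>\<^sub>m\<^sub>i\<^sub>n" and "\<sigma>\<^sub>m\<^sub>i\<^sub>n < 1"
    and "\<sigma> \<in> scale_class \<sigma>\<^sub>m\<^sub>i\<^sub>n" and "\<kappa> \<in> scale_class \<sigma>\<^sub>m\<^sub>i\<^sub>n"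
    and "h C1_differentiable_on UNIV"
    and "continuous_on UNIV \<psi>" and "\<And>t. \<psi> t \<ge> 0" and "bounded (range \<psi>)"
    and "continuous_on UNIV \<phi>" and "\<And>t. \<phi> t \<ge> 0" and "bounded (range \<phi>)"
    and "\<And>t. cmod (h t) \<le> \<psi> t / (1 + \<bar>t\<bar>)"
    and "\<And>t. cmod (vector_derivative h (at t)) \<le> \<phi> t / (1 + t\<^sup>2)"
    and "f \<in> L2_space lebesgue"
  shows "(\<lambda>z. transform h \<sigma> f z - transform h \<kappa> f z) \<in> L2_space lebesgue \<and>
    L2_norm lebesgue (\<lambda>z. transform h \<sigma> f z - transform h \<kappa> f z)
      \<le> C1 \<sigma>\<^sub>m\<^sub>i\<^sub>n \<psi> \<phi> \<sigma> \<kappa> * Linf_norm (\<lambda>t. \<sigma> t - \<kappa> t) * L2_norm lebesgue f"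
proof -
  let ?s = \<sigma>\<^sub>m\<^sub>i\<^sub>n
  define L where "L = Linf_norm (\<lambda>t. \<sigma> t - \<kappa> t)"
  define K where "K = L * C1 ?s \<psi> \<phi> \<sigma> \<kappa>"
  have cont: "continuous_on UNIV \<sigma>" "continuous_on UNIV \<kappa>" and lower: "\<And>t. ?s \<le> \<sigma> t" "\<And>t. ?s \<le> \<kappa> t"
    using assms(3,4) by (auto simp: scale_class_def)
  note bdd = scale_class_bounded[OF assms(3)] scale_class_bounded[OF assms(4)]
  have \<sigma>_le: "\<sigma> t \<le> Linf_norm \<sigma>" and \<kappa>_le: "\<kappa> t \<le> Linf_norm \<kappa>" for t
    using abs_le_Linf_norm[OF cont(1) bdd(1), of t] abs_le_Linf_norm[OF cont(2) bdd(2), of t] by auto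
  have "bounded (range (\<lambda>t. \<sigma> t - \<kappa> t))"
    using bounded_minus_comp[OF bdd] by simp
  then have diff: "\<bar>\<sigma> t - \<kappa> t\<bar> \<le> L" for t
    unfolding L_def by (intro abs_le_Linf_norm continuous_intros cont)
  have \<psi>_le: "\<psi> t \<le> Linf_norm \<psi>" and \<phi>_le: "\<phi> t \<le> Linf_norm \<phi>" for t
    using abs_le_Linf_norm[OF assms(6,8), of t] abs_le_Linf_norm[OF assms(9,11), of t] by auto
  have decay: "cmod (h t) \<le> Linf_norm \<psi> / (1 + \<bar>t\<bar>)" for t
    by (rule order_trans[OF assms(12)]) (intro divide_right_mono \<psi>_le, simp)
  have deriv_decay: "cmod (vector_derivative h (at t)) \<le> Linf_norm \<phi> / (1 + t\<^sup>2)" for t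
    by (rule order_trans[OF assms(13)]) (intro divide_right_mono \<phi>_le, simp)
  have deriv: "(h has_vector_derivative vector_derivative h (at t)) (at t)" for t
    using assms(5) by (auto simp: C1_differentiable_on_eq vector_derivative_works)
  have "continuous_on UNIV h"
    by (intro continuous_at_imp_continuous_on ballI has_vector_derivative_continuous[OF deriv])
  then have [measurable]: "h \<in> borel_measurable borel" "\<sigma> \<in> borel_measurable borel" "\<kappa> \<in> borel_measurable borel"
    using cont by (auto intro: borel_measurable_continuous_onI)
  have K_nonneg: "K \<ge> 0"
  proof -
    have "0 \<le> Linf_norm \<psi>" "0 \<le> Linf_norm \<phi>" "0 \<le> L"
      using order_trans[OF assms(7) \<psi>_le] order_trans[OF assms(10) \<phi>_le] order_trans[OF abs_ge_zero diff]
      by blast+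
    then show ?thesis
      using assms(1) by (auto simp: K_def C1_def intro!: mult_nonneg_nonneg add_nonneg_nonneg)
  qed
  have f [measurable]: "f \<in> borel_measurable lebesgue" and f_int: "integrable lebesgue (\<lambda>x. (cmod (f x))\<^sup>2)"
    using assms(14) by (auto simp: L2_space_def)
  obtain g where [measurable]: "g \<in> borel_measurable borel" and ae: "AE x in lborel. f x = g x"
    by (rule lebesgue_ex_borel_measurable_complex[OF f])
  have g_leb [measurable]: "g \<in> borel_measurable lebesgue"
    by (intro measurable_completion) simp
  have ae_sq: "AE x in lebesgue. (cmod (f x))\<^sup>2 = (cmod (g x))\<^sup>2"
    using AE_completion[OF ae] by eventually_elim simp
  have g_int: "integrable lborel (\<lambda>x. (cmod (g x))\<^sup>2)"
  proof -
    have "integrable lebesgue (\<lambda>x. (cmod (g x))\<^sup>2)"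
      using f_int by (rule integrable_cong_AE_imp) (use ae_sq in \<open>auto elim: eventually_mono\<close>)
    then show ?thesis
      by (simp add: integrable_completion)
  qed
  have f_norm: "(L2_norm lebesgue f)\<^sup>2 = (\<integral>x. (cmod (g x))\<^sup>2 \<partial>lborel)"
  proof -
    have "(\<integral>x. (cmod (f x))\<^sup>2 \<partial>lebesgue) = (\<integral>x. (cmod (g x))\<^sup>2 \<partial>lebesgue)"
      using ae_sq by (intro integral_cong_AE) auto
    also have "\<dots> = (\<integral>x. (cmod (g x))\<^sup>2 \<partial>lborel)"
      by (intro integral_completion) simp
    finally show ?thesis
      by (simp add: L2_norm_def)
  qed
  \<comment> \<open>The conjugate comes from the second argument of \<open>L2_inner\<close>.\<close>
  define G where "G = (\<lambda>t x. cnj (dilated h \<sigma> t x - dilated h \<kappa> t x))"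
  have G [measurable]: "case_prod G \<in> borel_measurable (borel \<Otimes>\<^sub>M borel)"
    unfolding G_def by measurable
  have int: "integrable lborel (\<lambda>x. g x * cnj (dilated h \<tau> t x))" if "?s \<le> \<tau> t" for \<tau> t
  proof (rule integrable_mult_square_integrable)
    have "integrable lborel (\<lambda>x. (cmod (dilated h \<tau> t x))\<^sup>2)"
      by (rule integrable_dilated_square[where s = ?s and P = "Linf_norm \<psi>"])
        (use assms(1) that decay in auto)
    then show "integrable lborel (\<lambda>x. (cmod (cnj (dilated h \<tau> t x)))\<^sup>2)"
      by simp
    show "(\<lambda>x. cnj (dilated h \<tau> t x)) \<in> borel_measurable lborel"
      unfolding dilated_def by measurable
  qed (use g_int in auto)
  note int = int[of \<sigma>, OF lower(1)] int[of \<kappa>, OF lower(2)]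
  have G_int: "integrable lborel (\<lambda>x. g x * G t x)" for t
    using Bochner_Integration.integrable_diff[OF int] by (simp add: G_def right_diff_distrib)
  define D where "D = (\<lambda>(t, \<omega>). fourier_integral (\<lambda>x. g x * G t x) \<omega>)"
  have D_eq: "(\<lambda>z. transform h \<sigma> f z - transform h \<kappa> f z) = D"
  proof (intro ext, clarify)
    fix t \<omega>
    \<comment> \<open>Subtracting two Bochner integrals requires each integrand to be integrable by
      itself; multiplication by a phase preserves this.\<close>
    have cis_int: "integrable lborel (\<lambda>x. F x * cis (- (2 * pi * \<omega> * x)))"
      if "integrable lborel F" for F :: "real \<Rightarrow> complex"
    proof -
      have [measurable]: "F \<in> borel_measurable borel"
        using that by (auto dest: borel_measurable_integrable)
      show ?thesis
        using that by (rule Bochner_Integration.integrable_bound) (auto simp: norm_mult)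
    qed
    show "transform h \<sigma> f (t, \<omega>) - transform h \<kappa> f (t, \<omega>) = D (t, \<omega>)"
      unfolding transform_eq_fourier_integral[OF f \<open>g \<in> borel_measurable borel\<close> \<open>h \<in> borel_measurable borel\<close> ae]
      unfolding D_def G_def fourier_integral_def prod.case
      by (subst Bochner_Integration.integral_diff[symmetric, OF cis_int[OF int(1)] cis_int[OF int(2)]])
        (simp add: algebra_simps)
  qed
  have D_meas [measurable]: "D \<in> borel_measurable borel"
    unfolding D_def fourier_integral_def borel_prod[symmetric] by measurable
  have "(\<integral>\<^sup>+z. ennreal ((cmod (D z))\<^sup>2) \<partial>lborel)
      \<le> ennreal (K\<^sup>2) * (\<integral>\<^sup>+x. ennreal ((cmod (g x))\<^sup>2) \<partial>lborel)"
  proof -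
    have "(\<integral>\<^sup>+t. ennreal ((cmod (G t x))\<^sup>2) \<partial>lborel) \<le> ennreal (K\<^sup>2)" for x
    proof -
      have nonneg: "0 \<le> Linf_norm \<sigma>" "0 \<le> Linf_norm \<kappa>"
        using assms(1) lower(1)[of 0] \<sigma>_le[of 0] lower(2)[of 0] \<kappa>_le[of 0] by linarith+
      show ?thesis
        unfolding K_def G_def complex_mod_cnj C1_eq_sqrt[OF assms(1) nonneg]
        by (intro nn_integral_dilated_difference_le[where h' = "\<lambda>t. vector_derivative h (at t)"]
            assms(1) lower \<sigma>_le \<kappa>_le diff decay deriv deriv_decay)
    qed
    from short_time_fourier_L2_le[OF _ G G_int this] show ?thesis
      by (simp add: D_def lborel_prod case_prod_unfold)
  qed
  also have "\<dots> = ennreal (K\<^sup>2) * ennreal ((L2_norm lebesgue f)\<^sup>2)"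
    unfolding f_norm using g_int by (subst nn_integral_eq_integral) auto
  also have "\<dots> = ennreal ((K * L2_norm lebesgue f)\<^sup>2)"
    by (simp add: power_mult_distrib flip: ennreal_mult)
  finally have main: "(\<integral>\<^sup>+z. ennreal ((cmod (D z))\<^sup>2) \<partial>lborel) \<le> ennreal ((K * L2_norm lebesgue f)\<^sup>2)" .
  \<comment> \<open>Finiteness of the nonnegative integral gives square integrability, and only then
    can the bound be read as one between real integrals, first over \<open>lborel\<close> and then
    over its completion.\<close>
  have D_int: "integrable lborel (\<lambda>z. (cmod (D z))\<^sup>2)"
    using main by (intro integrableI_bounded) (auto intro: le_less_trans)
  have "(\<integral>z. (cmod (D z))\<^sup>2 \<partial>lborel) \<le> (K * L2_norm lebesgue f)\<^sup>2"
    using main D_int by (simp add: nn_integral_eq_integral)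
  then have "L2_norm lebesgue D \<le> K * L2_norm lebesgue f"
    using K_nonneg unfolding L2_norm_def
    by (subst integral_completion) (auto intro!: real_le_lsqrt)
  moreover have "D \<in> L2_space lebesgue"
    unfolding L2_space_def using D_int by (auto simp: integrable_completion intro: measurable_completion)
  ultimately show ?thesis
    unfolding D_eq K_def L_def by (simp add: mult_ac)
qed

end
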